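(* For the merging problem with $n=3$ items and $k=2$ slots, the G-CHANGE mechanism is optimal: $\mathrm{OBJ}(\mathcal M^C)=\mathrm{OBJ}(\mathcal M^* )$.
   Context: Merging problem: $n$ items indexed by $[n]$, $k\le n$ slots. Each item $i$ has a random ad value $a_i$, drawn independently from a regular distribution $G_i$ ($\boldsymbol a\sim G=\times_i G_i$), and a fixed organic value $o_i\ge0$. A mechanism is a pair of allocation rules $x,y$ with $x_i(\boldsymbol a),y_i(\boldsymbol a)\in\{0,1\}$ ($x_i=1$: item $i$ shown as ad; $y_i=1$: shown organically) satisfying for all $\boldsymbol a,i$: (i) $\sum_i(x_i+y_i)\le k$; (ii) $x_i+y_i\le 1$; (iii) $y_i(a_i,\boldsymbol a_{-i})$ independent of $a_i$; (iv) $x_i(a_i,\boldsymbol a_{-i})$ non-decreasing in $a_i$. Objective $\mathrm{OBJ}=\mathbb E_{\boldsymbol a\sim G}[\sum_i(a_ix_i(\boldsymbol a)+o_iy_i(\boldsymbol a))]$; $\mathcal M^*$ maximizes it subject to (i)–(iv). Notation: $\max^{(m)}S$ is the sum of the $m$ largest elements of a finite multiset $S$ ($\max^{(0)}S=0$); $\mathbb E_{a_j}[\cdot]$ denotes expectation over $a_j\sim G_j$ only, the other coordinates held fixed. G-CHANGE-$I$ mechanism $\mathcal M^C_I$, for an ordered list $I=(i_1,\dots,i_k)$ of distinct items: for $t\in[k]$ let $R_t=\sum_{j=1}^{t-1}o_{i_j}+\max^{(k-t)}\{a_i: i\notin\{i_1,\dots,i_t\}\}$, and define recursively $w_{i_1}^{\boldsymbol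 a}=\mathbb E_{a_{i_1}}[\max^{(k)}\{a_1,\dots,a_n\}]-R_1$ and, for $t>1$, $w_{i_t}^{\boldsymbol a}=\mathbb E_{a_{i_t}}[\max\{o_{i_{t-1}}+R_{t-1},\,w_{i_{t-1}}^{\boldsymbol a}+R_{t-1}\}]-R_t$. Let $s^*$ be the largest $s\in[k]$ with $o_{i_s}\ge w_{i_s}^{\boldsymbol a}$ and $o_{i_t}<w_{i_t}^{\boldsymbol a}$ for all $t>s$ (and $s^*=0$ if none). The mechanism shows $i_1,\dots,i_{s^*}$ in organic form and shows as ads the $k-s^*$ items outside $\{i_1,\dots,i_{s^*}\}$ with the largest $a_i$. Its objective is $\mathrm{OBJ}(\mathcal M^C_I)=\mathbb E_{\boldsymbol a\sim G}\big[\max\{\sum_{j=1}^k o_{i_j},\ w_{i_k}^{\boldsymbol a}+\sum_{j=1}^{k-1}o_{i_j}\}\big]$. The G-CHANGE mechanism $\mathcal M^C$ runs the $\mathcal M^C_I$ of highest objective over all ordered lists $I$ of $k$ distinct items of $[n]$, so $\mathrm{OBJ}(\mathcal M^C)=\max_I\mathrm{OBJ}(\mathcal M^C_I)$.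
   Formalization: Ad values are additionally assumed almost surely nonnegative with finite mean (and mechanisms measurable); with negative ad values the claim fails, e.g. three uniform [-1,1] ads and all organic values 0, where leaving slots empty beats G-CHANGE. *)

theory Defs
  imports "HOL-Probability.Probability"
begin

text \<open>Items are indexed by {..<n} (i.e. 0,...,n-1, standing for [n]); a profile of ad
values is a function a :: nat => real (coordinates >= n are irrelevant).\<close>

definition regular_dist :: "real measure \<Rightarrow> bool" where
  "regular_dist M \<longleftrightarrow> prob_space M \<and>
     (\<exists>f. f \<in> borel_measurable borel \<and> (\<forall>v. 0 \<le> f v) \<and>
          M = density lborel (\<lambda>v. ennreal (f v)) \<and>
          is_interval {v. 0 < f v} \<and>
          mono_on {v. 0 < f v} (\<lambda>v. v - (1 - measure M {..v}) / f v))"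

definition topk :: "nat \<Rightarrow> nat set \<Rightarrow> (nat \<Rightarrow> real) \<Rightarrow> real" where
  "topk m A a = sum_list (take m (rev (sort (map a (sorted_list_of_set A)))))"

text \<open>R_t for the ordered list I = (i_1,...,i_k), where i_t = I ! (t-1); t is 1-based.\<close>
definition RC :: "(nat \<Rightarrow> real) \<Rightarrow> nat \<Rightarrow> nat \<Rightarrow> nat list \<Rightarrow> nat \<Rightarrow> (nat \<Rightarrow> real) \<Rightarrow> real" where
  "RC org n k I t a = (\<Sum>j<t-1. org (I ! j)) + topk (k - t) ({..<n} - set (take t I)) a"

text \<open>w_{i_t}^a (t is 1-based; the value at t = 0 is a dummy). The partial expectation
E_{a_j}[h a] is the integral of h (a(j := v)) over v ~ G j.\<close>
fun wC :: "(nat \<Rightarrow> real measure) \<Rightarrow> (nat \<Rightarrow> real) \<Rightarrow> nat \<Rightarrow> nat \<Rightarrow> nat list \<Rightarrow> nat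
            \<Rightarrow> (nat \<Rightarrow> real) \<Rightarrow> real" where
  "wC G org n k I 0 a = 0"
| "wC G org n k I (Suc 0) a =
     (\<integral>v. topk k {..<n} (a(I ! 0 := v)) \<partial>(G (I ! 0))) - RC org n k I 1 a"
| "wC G org n k I (Suc (Suc t)) a =
     (\<integral>v. max (org (I ! t) + RC org n k I (Suc t) (a(I ! Suc t := v)))
              (wC G org n k I (Suc t) (a(I ! Suc t := v)) + RC org n k I (Suc t) (a(I ! Suc t := v)))
        \<partial>(G (I ! Suc t)))
     - RC org n k I (Suc (Suc t)) a"

definition OBJ_CI :: "(nat \<Rightarrow> real measure) \<Rightarrow> (nat \<Rightarrow> real) \<Rightarrow> nat \<Rightarrow> nat \<Rightarrow> nat list \<Rightarrow> real" where
  "OBJ_CI G org n k I =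
     (\<integral>a. max (\<Sum>j<k. org (I ! j)) (wC G org n k I k a + (\<Sum>j<k-1. org (I ! j)))
        \<partial>(PiM {..<n} G))"

definition ordered_lists :: "nat \<Rightarrow> nat \<Rightarrow> nat list set" where
  "ordered_lists n k = {I. distinct I \<and> length I = k \<and> set I \<subseteq> {..<n}}"

definition OBJ_C :: "(nat \<Rightarrow> real measure) \<Rightarrow> (nat \<Rightarrow> real) \<Rightarrow> nat \<Rightarrow> nat \<Rightarrow> real" where
  "OBJ_C G org n k = Max (OBJ_CI G org n k ` ordered_lists n k)"

text \<open>Feasible mechanisms: x a i (ad) and y a i (organic) for profile a and item i.\<close>
definition feasible_mech :: "(nat \<Rightarrow> real measure) \<Rightarrow> nat \<Rightarrow> nat
     \<Rightarrow> ((nat \<Rightarrow> real) \<Rightarrow> nat \<Rightarrow> bool) \<Rightarrow> ((nat \<Rightarrow> real) \<Rightarrow> nat \<Rightarrow> bool) \<Rightarrow> bool" where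
  "feasible_mech G n k x y \<longleftrightarrow>
     (\<forall>i<n. (\<lambda>a. x a i) \<in> measurable (PiM {..<n} G) (count_space UNIV) \<and>
            (\<lambda>a. y a i) \<in> measurable (PiM {..<n} G) (count_space UNIV)) \<and>
     (\<forall>a. (\<Sum>i<n. of_bool (x a i) + of_bool (y a i)) \<le> (k::nat)) \<and>
     (\<forall>a. \<forall>i<n. \<not> (x a i \<and> y a i)) \<and>
     (\<forall>a i v. i < n \<longrightarrow> y (a(i := v)) i = y a i) \<and>
     (\<forall>a i v v'. i < n \<longrightarrow> v \<le> v' \<longrightarrow> x (a(i := v)) i \<longrightarrow> x (a(i := v')) i)"

definition OBJ_mech :: "(nat \<Rightarrow> real measure) \<Rightarrow> (nat \<Rightarrow> real) \<Rightarrow> nat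
     \<Rightarrow> ((nat \<Rightarrow> real) \<Rightarrow> nat \<Rightarrow> bool) \<Rightarrow> ((nat \<Rightarrow> real) \<Rightarrow> nat \<Rightarrow> bool) \<Rightarrow> real" where
  "OBJ_mech G org n x y =
     (\<integral>a. (\<Sum>i<n. a i * of_bool (x a i) + org i * of_bool (y a i)) \<partial>(PiM {..<n} G))"

end

theory Submission
  imports Defs
begin

text \<open>Choose a threshold \<open>t\<^sub>i \<ge> 0\<close> with \<open>E max a\<^sub>i t\<^sub>i = o\<^sub>i\<close>, or \<open>t\<^sub>i = 0\<close> if \<open>o\<^sub>i \<le> E a\<^sub>i\<close>. As the
organic decision for item \<open>i\<close> is independent of \<open>a\<^sub>i\<close>, replacing the organic value \<open>o\<^sub>i\<close> by the
random value \<open>b\<^sub>i = max a\<^sub>i t\<^sub>i \<ge> a\<^sub>i\<close> does not decrease the objective of any mechanism, so no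
mechanism beats \<open>V\<close>, the expected sum of the two largest \<open>b\<^sub>i\<close>. If \<open>t\<^sub>r \<le> t\<^sub>q \<le> t\<^sub>p\<close>, then \<open>V\<close>
is attained: show \<open>p\<close> and \<open>q\<close> organically if \<open>a\<^sub>r < t\<^sub>q\<close>, otherwise \<open>p\<close> organically if
\<open>min a\<^sub>q a\<^sub>r < t\<^sub>p\<close>, and fill the remaining slots with the best ads; this always realises the two
largest \<open>b\<^sub>i\<close>. G-CHANGE along \<open>(p, q)\<close> takes, stage by stage, the best conditional
expectation among these options, so it has objective at least \<open>V\<close>, while for every list it is bounded by \<open>V\<close>.\<close>

section \<open>Averaging over one coordinate and the choice of a threshold\<close>

text \<open>Resampling coordinate \<open>i\<close> independently from \<open>M i\<close> leaves the
  product measure unchanged. Fubini then lets one coordinate be averaged out at a time.\<close>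

lemma PiM_average_component:
  fixes f :: "('i \<Rightarrow> 'a) \<Rightarrow> real"
  assumes prob: "\<And>j. j \<in> K \<Longrightarrow> prob_space (M j)" and i: "i \<in> K"
    and f: "integrable (PiM K M) f"
  shows "integrable (PiM K M) (\<lambda>a. \<integral>v. f (a(i := v)) \<partial>M i)"
    and "(\<integral>a. (\<integral>v. f (a(i := v)) \<partial>M i) \<partial>PiM K M) = (\<integral>a. f a \<partial>PiM K M)"
proof -
  interpret Mi: prob_space "M i" using prob i .
  interpret P: prob_space "PiM K M" by (intro prob_space_PiM prob)
  interpret pair_sigma_finite "M i" "PiM K M" ..
  have ins: "insert i K = K" using i by auto
  have D: "distr (M i \<Otimes>\<^sub>M PiM K M) (PiM K M) (\<lambda>(v, a). a(i := v)) = PiM K M"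
    using distr_pair_PiM_eq_PiM[of K M i] prob i by (simp add: ins)
  have upd[measurable]: "(\<lambda>(v, a). a(i := v)) \<in> M i \<Otimes>\<^sub>M PiM K M \<rightarrow>\<^sub>M PiM K M"
  proof -
    have "(\<lambda>(v, a). a(i := v)) \<in> M i \<Otimes>\<^sub>M PiM K M \<rightarrow>\<^sub>M PiM (insert i K) M"
      by measurable
    then show ?thesis by (simp add: ins)
  qed
  have [measurable]: "f \<in> borel_measurable (PiM K M)" using f by auto
  have I: "integrable (M i \<Otimes>\<^sub>M PiM K M) (\<lambda>(v, a). f (a(i := v)))"
    using integrable_distr[OF upd, of f] f unfolding D by (simp add: case_prod_beta')
  show "integrable (PiM K M) (\<lambda>a. \<integral>v. f (a(i := v)) \<partial>M i)"
    using integrable_snd[OF I] .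
  have "(\<integral>a. (\<integral>v. f (a(i := v)) \<partial>M i) \<partial>PiM K M) =
      (\<integral>(v, a). f (a(i := v)) \<partial>(M i \<Otimes>\<^sub>M PiM K M))"
    using integral_snd[OF I] .
  also have "\<dots> = (\<integral>a. f a \<partial>distr (M i \<Otimes>\<^sub>M PiM K M) (PiM K M) (\<lambda>(v, a). a(i := v)))"
    by (subst integral_distr) (auto simp: case_prod_beta')
  finally show "(\<integral>a. (\<integral>v. f (a(i := v)) \<partial>M i) \<partial>PiM K M) = (\<integral>a. f a \<partial>PiM K M)"
    by (simp add: D)
qed

lemma integrable_PiM_component:
  fixes f :: "'a \<Rightarrow> real"
  assumes "\<And>j. j \<in> K \<Longrightarrow> prob_space (M j)" and "i \<in> K" and "integrable (M i) f"
  shows "integrable (PiM K M) (\<lambda>a. f (a i))"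
proof -
  have "integrable (distr (PiM K M) (M i) (\<lambda>a. a i)) f"
    using assms by (subst distr_PiM_component) auto
  then show ?thesis
    by (rule integrable_distr[rotated]) (use assms in measurable)
qed

lemma integrable_max_const:
  fixes M :: "real measure"
  assumes "prob_space M" "integrable M (\<lambda>v. v)"
  shows "integrable M (\<lambda>v. max v c)"
proof -
  interpret prob_space M by fact
  show ?thesis using assms by (intro integrable_max) auto
qed

text \<open>The expectation of \<open>max v t\<close> is 1-Lipschitz in \<open>t\<close> and at
  least \<open>o'\<close> at \<open>t = o'\<close>. If it is below \<open>o'\<close> at
  \<open>t = 0\<close>, the intermediate value theorem gives equality in between; otherwise
  \<open>t = 0\<close> serves.\<close>

lemma expectation_max_threshold:
  fixes M :: "real measure"
  assumes "prob_space M" and int: "integrable M (\<lambda>v. v)"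
    and nonneg: "0 \<le> o'"
  obtains t where "0 \<le> t" "o' \<le> (\<integral>v. max v t \<partial>M)" "0 < t \<Longrightarrow> (\<integral>v. max v t \<partial>M) = o'"
proof (cases "o' \<le> (\<integral>v. max v 0 \<partial>M)")
  case True
  then show ?thesis using that[of 0] by auto
next
  case False
  interpret prob_space M by fact
  note I = integrable_max_const[OF assms(1,2)]
  have "\<bar>(\<integral>v. max v s \<partial>M) - (\<integral>v. max v t \<partial>M)\<bar> \<le> \<bar>s - t\<bar>" for s t
  proof -
    have "\<bar>\<integral>v. max v s - max v t \<partial>M\<bar> \<le> (\<integral>v. \<bar>s - t\<bar> \<partial>M)"
      by (rule order_trans[OF integral_abs_bound], rule integral_mono)
         (use I in \<open>auto simp: max_def\<close>)
    then show ?thesis using I by (simp add: Bochner_Integration.integral_diff prob_space)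
  qed
  then have "1-lipschitz_on UNIV (\<lambda>t. \<integral>v. max v t \<partial>M)"
    by (intro lipschitz_onI) (auto simp: dist_real_def)
  then have "continuous_on {0..o'} (\<lambda>t. \<integral>v. max v t \<partial>M)"
    using lipschitz_on_continuous_on continuous_on_subset by blast
  moreover have "o' \<le> (\<integral>v. max v o' \<partial>M)"
    using integral_mono[of M "\<lambda>_. o'" "\<lambda>v. max v o'"] I by (simp add: prob_space)
  ultimately obtain t where "0 \<le> t" "(\<integral>v. max v t \<partial>M) = o'"
    using IVT'[of "\<lambda>t. \<integral>v. max v t \<partial>M" 0 o' o'] False nonneg by auto
  then show ?thesis using that by auto
qed

section \<open>The sum of the two largest of three values\<close>

text \<open>A maximum over pairs replaces sorting, so that measurability, integrability and case
  analysis reduce to \<open>max\<close> and addition.\<close>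

definition top2 :: "real \<Rightarrow> real \<Rightarrow> real \<Rightarrow> real" where
  "top2 u v w = max (u + v) (max (u + w) (v + w))"

lemma measurable_top2[measurable (raw)]:
  assumes [measurable]: "f \<in> borel_measurable M" "g \<in> borel_measurable M" "h \<in> borel_measurable M"
  shows "(\<lambda>x. top2 (f x) (g x) (h x)) \<in> borel_measurable M"
  unfolding top2_def by measurable

lemma topk_two_of_three:
  assumes "{p, q, r} = {..<3}" "distinct [p, q, r]"
  shows "topk 2 {..<3} a = top2 (a p) (a q) (a r)"
proof -
  have L: "sorted_list_of_set {..<3::nat} = [0, 1, 2]"
    by (simp add: atLeast0LessThan[symmetric] upt_rec)
  have "p < 3" "q < 3" "r < 3" using assms by auto
  then have "(p, q, r) \<in> {(0,1,2), (0,2,1), (1,0,2), (1,2,0), (2,0,1), (2,1,0)}"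
    using assms by (auto simp: numeral_3_eq_3 less_Suc_eq numeral_2_eq_2)
  then show ?thesis
    by (auto simp: topk_def L top2_def max_def insort_key.simps numeral_2_eq_2)
qed

lemma topk_one_of_two:
  assumes "q \<noteq> r"
  shows "topk 1 {q, r} a = max (a q) (a r)"
  using assms by (cases "q < r") (auto simp: topk_def max_def)

lemma pred_real_le:
  fixes f g :: "'a \<Rightarrow> real"
  assumes "f \<in> borel_measurable M" "g \<in> borel_measurable M"
  shows "Measurable.pred M (\<lambda>x. f x \<le> g x)"
  using borel_measurable_le[OF assms] by (simp add: Measurable.pred_def)

lemma integrable_top2:
  assumes "integrable M f" "integrable M g" "integrable M h"
  shows "integrable M (\<lambda>x. top2 (f x) (g x) (h x))"
  unfolding top2_def
  by (intro integrable_max Bochner_Integration.integrable_add assms)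

lemma top2_mono: "u \<le> u' \<Longrightarrow> v \<le> v' \<Longrightarrow> w \<le> w' \<Longrightarrow> top2 u v w \<le> top2 u' v' w'"
  by (auto simp: top2_def max_def)

lemma top2_nonneg: "0 \<le> u \<Longrightarrow> 0 \<le> v \<Longrightarrow> 0 \<le> top2 u v w"
  by (auto simp: top2_def max_def)

text \<open>The cases match the outcomes of the optimal mechanism: \<open>p\<close> and
  \<open>q\<close> organic, only \<open>p\<close> organic, ads only. In the last one,
  \<open>max u tp\<close> differs from \<open>u\<close> only if \<open>u < tp\<close>, and then
  \<open>v\<close> and \<open>w\<close> are the two largest anyway.\<close>

lemma top2_lifted:
  assumes "tr \<le> tq" "tq \<le> tp"
  shows "w < tq \<Longrightarrow> top2 (max u tp) (max v tq) (max w tr) = max u tp + max v tq"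
    and "tq \<le> w \<Longrightarrow> min v w < tp \<Longrightarrow>
      top2 (max u tp) (max v tq) (max w tr) = max u tp + max v w"
    and "tq \<le> w \<Longrightarrow> tp \<le> min v w \<Longrightarrow>
      top2 (max u tp) (max v tq) (max w tr) = top2 u v w"
  using assms by (auto simp: top2_def max_def min_def split: if_splits)

section \<open>Lifted values and the upper bound for all mechanisms\<close>

text \<open>\<open>org_le\<close> serves the upper bound, \<open>org_eq\<close> the attainment. At
  \<open>t i = 0\<close> equality may fail; the optimal mechanism then almost never shows
  \<open>i\<close> organically.\<close>

locale thresholds =
  fixes G :: "nat \<Rightarrow> real measure" and org t :: "nat \<Rightarrow> real"
  assumes prob: "i < 3 \<Longrightarrow> prob_space (G i)"
    and sets_G: "i < 3 \<Longrightarrow> sets (G i) = sets borel"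
    and mean: "i < 3 \<Longrightarrow> integrable (G i) (\<lambda>v. v)"
    and ads_nonneg: "i < 3 \<Longrightarrow> AE v in G i. 0 \<le> v"
    and org_nonneg: "i < 3 \<Longrightarrow> 0 \<le> org i"
    and t_nonneg: "i < 3 \<Longrightarrow> 0 \<le> t i"
    and org_le: "i < 3 \<Longrightarrow> org i \<le> (\<integral>v. max v (t i) \<partial>G i)"
    and org_eq: "i < 3 \<Longrightarrow> 0 < t i \<Longrightarrow> org i = (\<integral>v. max v (t i) \<partial>G i)"
begin

abbreviation P where "P \<equiv> PiM {..<3} G"

definition V :: real where
  "V = (\<integral>a. topk 2 {..<3} (\<lambda>i. max (a i) (t i)) \<partial>P)"

lemma prob_P: "prob_space P"
  by (intro prob_space_PiM prob) auto

lemma integrable_lifted: "i < 3 \<Longrightarrow> integrable P (\<lambda>a. max (a i) (t i))"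
  by (rule integrable_PiM_component) (auto intro: prob integrable_max_const mean)

lemma integrable_ad: "i < 3 \<Longrightarrow> integrable P (\<lambda>a. a i)"
  by (rule integrable_PiM_component) (auto intro: prob mean)

lemma measurable_ad: "i < 3 \<Longrightarrow> (\<lambda>a. a i) \<in> borel_measurable P"
  using integrable_ad by blast

lemma AE_ads_nonneg: "AE a in P. \<forall>i<3. 0 \<le> a i"
proof -
  have "AE a in P. 0 \<le> a i" if "i < 3" for i
    by (rule AE_PiM_component) (use that prob ads_nonneg in auto)
  then have "AE a in P. \<forall>i\<in>{..<3}. 0 \<le> a i"
    by (intro AE_finite_allI) auto
  then show ?thesis by eventually_elim auto
qed

lemma integrable_times_indicator:
  fixes f :: "_ \<Rightarrow> real"
  assumes "integrable P f" "(\<lambda>a. z a) \<in> measurable P (count_space UNIV)"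
  shows "integrable P (\<lambda>a. f a * of_bool (z a))"
proof (rule Bochner_Integration.integrable_bound[OF assms(1)])
  have [measurable]: "f \<in> borel_measurable P" "z \<in> measurable P (count_space UNIV)"
    using assms by auto
  show "(\<lambda>a. f a * of_bool (z a)) \<in> borel_measurable P"
    by measurable
qed auto

text \<open>After averaging over coordinate \<open>i\<close>, the factor \<open>y\<close>, which
  ignores that coordinate, leaves the inner integral.\<close>

lemma organic_average:
  assumes i: "i < 3" and y: "y \<in> measurable P (count_space UNIV)"
    and indep: "\<And>a v. y (a(i := v)) = y a"
  shows "(\<integral>a. max (a i) (t i) * of_bool (y a) \<partial>P) =
    (\<integral>a. (\<integral>v. max v (t i) \<partial>G i) * of_bool (y a) \<partial>P)"
proof -
  have "(\<integral>a. max (a i) (t i) * of_bool (y a) \<partial>P) =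
      (\<integral>a. (\<integral>v. max ((a(i := v)) i) (t i) * of_bool (y (a(i := v))) \<partial>G i) \<partial>P)"
    by (rule PiM_average_component(2)[symmetric])
       (use i prob integrable_times_indicator[OF integrable_lifted y] in auto)
  then show ?thesis by (simp add: indep)
qed

lemma organic_le:
  assumes i: "i < 3" and y: "y \<in> measurable P (count_space UNIV)"
    and indep: "\<And>a v. y (a(i := v)) = y a"
  shows "(\<integral>a. org i * of_bool (y a) \<partial>P) \<le> (\<integral>a. max (a i) (t i) * of_bool (y a) \<partial>P)"
proof -
  interpret prob_space P by (rule prob_P)
  have I: "integrable P (\<lambda>a. c * of_bool (y a))" for c :: real
    by (rule integrable_times_indicator[OF _ y]) auto
  have "(\<integral>a. org i * of_bool (y a) \<partial>P) \<le> (\<integral>a. (\<integral>v. max v (t i) \<partial>G i) * of_bool (y a) \<partial>P)"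
    using I org_le[OF i] by (intro integral_mono) auto
  then show ?thesis using organic_average[OF assms] by simp
qed

text \<open>If \<open>t i = 0\<close>, both integrands vanish almost everywhere by
  \<open>null\<close>; otherwise \<open>org_eq\<close> makes the averaged identity exact.\<close>

lemma organic_eq:
  assumes i: "i < 3" and y: "y \<in> measurable P (count_space UNIV)"
    and indep: "\<And>a v. y (a(i := v)) = y a"
    and null: "t i = 0 \<Longrightarrow> AE a in P. \<not> y a"
  shows "(\<integral>a. org i * of_bool (y a) \<partial>P) = (\<integral>a. max (a i) (t i) * of_bool (y a) \<partial>P)"
proof (cases "t i = 0")
  case True
  note [measurable] = measurable_ad[OF i] y
  have zero: "AE a in P. of_bool (y a) = (0::real)"
    using null[OF True] by eventually_elim simp
  show ?thesis
    by (rule integral_cong_AE) (measurable, use zero in eventually_elim, simp)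
next
  case False
  then show ?thesis
    using organic_average[OF assms(1-3)] org_eq[OF i] t_nonneg[OF i] by simp
qed

text \<open>Separates the pointwise comparison with the two largest lifted values from a correction
  term, which is nonpositive for feasible mechanisms and zero for the optimal one.\<close>

lemma lifted_value:
  assumes x: "\<And>i. i < 3 \<Longrightarrow> (\<lambda>a. x a i) \<in> measurable P (count_space UNIV)"
    and y: "\<And>i. i < 3 \<Longrightarrow> (\<lambda>a. y a i) \<in> measurable P (count_space UNIV)"
  shows "OBJ_mech G org 3 x y =
    (\<integral>a. (\<Sum>i<3. a i * of_bool (x a i) + max (a i) (t i) * of_bool (y a i)) \<partial>P)
    + (\<Sum>i<3. (\<integral>a. org i * of_bool (y a i) \<partial>P) - (\<integral>a. max (a i) (t i) * of_bool (y a i) \<partial>P))"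
proof -
  interpret prob_space P by (rule prob_P)
  note I = integrable_times_indicator[OF integrable_ad x]
    integrable_times_indicator[OF integrable_lifted y]
  have J: "integrable P (\<lambda>a. org i * of_bool (y a i))" if "i < 3" for i
    by (rule integrable_times_indicator[OF _ y[OF that]]) auto
  have "OBJ_mech G org 3 x y =
      (\<Sum>i<3. (\<integral>a. a i * of_bool (x a i) \<partial>P) + (\<integral>a. org i * of_bool (y a i) \<partial>P))"
    unfolding OBJ_mech_def using I J
    by (subst Bochner_Integration.integral_sum)
       (auto intro!: sum.cong Bochner_Integration.integral_add)
  moreover have "(\<integral>a. (\<Sum>i<3. a i * of_bool (x a i) + max (a i) (t i) * of_bool (y a i)) \<partial>P) =
      (\<Sum>i<3. (\<integral>a. a i * of_bool (x a i) \<partial>P) + (\<integral>a. max (a i) (t i) * of_bool (y a i) \<partial>P))"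
    using I
    by (subst Bochner_Integration.integral_sum)
       (auto intro!: sum.cong Bochner_Integration.integral_add)
  ultimately show ?thesis
    by (simp only: sum.distrib sum_subtractf)
qed

lemma integrable_V: "integrable P (\<lambda>a. topk 2 {..<3} (\<lambda>i. max (a i) (t i)))"
proof -
  have *: "{0, 1, 2} = {..<3::nat}" "distinct [0, 1, 2::nat]" by auto
  show ?thesis
    unfolding topk_two_of_three[OF *]
    by (intro integrable_top2 integrable_lifted) auto
qed

lemma mechanism_le:
  assumes "feasible_mech G 3 2 x y"
  shows "OBJ_mech G org 3 x y \<le> V"
proof -
  note F = assms[unfolded feasible_mech_def]
  have x: "(\<lambda>a. x a i) \<in> measurable P (count_space UNIV)"
    and y: "(\<lambda>a. y a i) \<in> measurable P (count_space UNIV)" if "i < 3" for i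
    using F that by auto
  have "(\<integral>a. (\<Sum>i<3. a i * of_bool (x a i) + max (a i) (t i) * of_bool (y a i)) \<partial>P) \<le> V"
    unfolding V_def
  proof (rule integral_mono_AE[OF _ integrable_V])
    show "integrable P (\<lambda>a. \<Sum>i<3. a i * of_bool (x a i) + max (a i) (t i) * of_bool (y a i))"
      by (intro Bochner_Integration.integrable_sum Bochner_Integration.integrable_add
          integrable_times_indicator integrable_ad integrable_lifted x y) auto
    have *: "{0, 1, 2} = {..<3::nat}" "distinct [0, 1, 2::nat]" by auto
    have "(\<Sum>i<3. a i * of_bool (x a i) + max (a i) (t i) * of_bool (y a i))
        \<le> topk 2 {..<3} (\<lambda>i. max (a i) (t i))" for a
    proof -
      \<comment> \<open>Nonnegative lifted values cover profiles in which fewer than two items are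
        shown.\<close>
      have n: "0 \<le> max (a i) (t i)" if "i < 3" for i
        using t_nonneg[OF that] by auto
      have excl: "\<not> (x a i \<and> y a i)" if "i < 3" for i using F that by blast
      have sum3: "(\<Sum>i<3. f i) = f 0 + f 1 + f 2" for f :: "nat \<Rightarrow> 'c::comm_monoid_add"
        by (simp add: numeral_3_eq_3 numeral_2_eq_2)
      \<comment> \<open>\<open>z\<close> marks the items shown in either form; an item shown as an
        ad is worth at most its lifted value.\<close>
      define z where "z i = (x a i \<or> y a i)" for i
      have "(\<Sum>i<3. a i * of_bool (x a i) + max (a i) (t i) * of_bool (y a i))
          \<le> (\<Sum>i<3. max (a i) (t i) * of_bool (z i))"
        using excl by (intro sum_mono) (auto simp: z_def)
      also have "\<dots> \<le> topk 2 {..<3} (\<lambda>i. max (a i) (t i))"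
      proof -
        have "(\<Sum>i<3. of_bool (x a i) + of_bool (y a i)) \<le> (2::nat)" using F by blast
        then have "\<not> (z 0 \<and> z 1 \<and> z 2)"
          using excl[of 0] excl[of 1] excl[of 2] unfolding sum3 z_def
          by (cases "x a 0"; cases "x a 1"; cases "x a 2") auto
        then show ?thesis
          unfolding topk_two_of_three[OF *] sum3 using n[of 0] n[of 1] n[of 2]
          by (cases "z 0"; cases "z 1"; cases "z 2")
             (simp_all add: top2_def le_max_iff_disj del: max.bounded_iff)
      qed
      finally show ?thesis .
    qed
    then show "AE a in P. (\<Sum>i<3. a i * of_bool (x a i) + max (a i) (t i) * of_bool (y a i))
        \<le> topk 2 {..<3} (\<lambda>i. max (a i) (t i))"
      by simp
  qed
  moreover have "(\<integral>a. org i * of_bool (y a i) \<partial>P) \<le> (\<integral>a. max (a i) (t i) * of_bool (y a i) \<partial>P)"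
    if "i < 3" for i
    using F that by (intro organic_le) blast+
  then have "(\<Sum>i<3. (\<integral>a. org i * of_bool (y a i) \<partial>P)
      - (\<integral>a. max (a i) (t i) * of_bool (y a i) \<partial>P)) \<le> 0"
    by (intro sum_nonpos) auto
  ultimately show ?thesis
    using lifted_value[OF x y] by simp
qed

text \<open>The feasible mechanism attaining \<open>V\<close> when \<open>t r \<le> t q \<le> t p\<close>. Ties are broken so that exactly
two slots are filled and each ad allocation stays monotone.\<close>

definition change_x :: "nat \<Rightarrow> nat \<Rightarrow> nat \<Rightarrow> (nat \<Rightarrow> real) \<Rightarrow> nat \<Rightarrow> bool" where
  "change_x p q r a i \<longleftrightarrow>
     (i = p \<and> t p \<le> min (a q) (a r) \<and> min (a q) (a r) < a p) \<or>
     (i = q \<and> t q \<le> a r \<and> (a r \<le> a q \<or> max (t p) (a p) \<le> min (a q) (a r))) \<or>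
     (i = r \<and> t q \<le> a r \<and> (a q < a r \<or> max (t p) (a p) \<le> min (a q) (a r)))"

definition change_y :: "nat \<Rightarrow> nat \<Rightarrow> nat \<Rightarrow> (nat \<Rightarrow> real) \<Rightarrow> nat \<Rightarrow> bool" where
  "change_y p q r a i \<longleftrightarrow> (i = p \<and> min (a q) (a r) < t p) \<or> (i = q \<and> a r < t q)"

end

section \<open>G-CHANGE along any list \<open>[p, q]\<close> has objective at most
  \<open>V\<close>\<close>

text \<open>The thresholds carry no order here, because the bound must cover every ordered list;
  \<open>r\<close> is the item left out.\<close>

locale labelled_thresholds = thresholds +
  fixes p q r :: nat
  assumes perm: "{p, q, r} = {..<3}" "distinct [p, q, r]"
begin

lemma pqr_less: "p < 3" "q < 3" "r < 3" using perm by auto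

lemma pqr_neq: "p \<noteq> q" "p \<noteq> r" "q \<noteq> r" "q \<noteq> p" "r \<noteq> p" "r \<noteq> q" using perm by auto

lemma sum_pqr: "(\<Sum>i<3. f i) = f p + f q + f r" for f :: "nat \<Rightarrow> 'c::comm_monoid_add"
  unfolding perm(1)[symmetric] using pqr_neq by (simp add: add.assoc)

lemma less_3_iff: "i < 3 \<longleftrightarrow> i = p \<or> i = q \<or> i = r"
  unfolding lessThan_iff[symmetric] perm(1)[symmetric] by simp

text \<open>\<open>w\<close> stands for the ad value of the item \<open>r\<close> outside the list \<open>[p, q]\<close>; the partial expectations
in the definition of G-CHANGE integrate out the other two items.\<close>

definition lifted_given :: "real \<Rightarrow> real" where
  "lifted_given w =
     (\<integral>v. (\<integral>u. top2 (max u (t p)) (max v (t q)) (max w (t r)) \<partial>G p) \<partial>G q)"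

definition change_given :: "real \<Rightarrow> real" where
  "change_given w = max (org p + org q)
     (\<integral>v. max (org p + max v w) (\<integral>u. top2 u v w \<partial>G p) \<partial>G q)"

lemma V_eq_lifted_given:
  shows "integrable P (\<lambda>a. lifted_given (a r))"
    and "V = (\<integral>a. lifted_given (a r) \<partial>P)"
proof -
  note average = PiM_average_component[of "{..<3}" G, OF prob]
  have V1: "integrable P (\<lambda>a. \<integral>u. top2 (max u (t p)) (max (a q) (t q)) (max (a r) (t r)) \<partial>G p)"
    "V = (\<integral>a. (\<integral>u. top2 (max u (t p)) (max (a q) (t q)) (max (a r) (t r)) \<partial>G p) \<partial>P)"
    using average[OF _ _ integrable_V, of p] pqr_less pqr_neq
    by (simp_all add: topk_two_of_three[OF perm] V_def)
  show "integrable P (\<lambda>a. lifted_given (a r))" "V = (\<integral>a. lifted_given (a r) \<partial>P)"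
    using average[OF _ _ V1(1), of q] pqr_less pqr_neq
    by (simp_all add: V1(2) lifted_given_def)
qed

text \<open>Each \<open>RC\<close> term subtracted in \<open>wC\<close> is added back at the next
  stage. What remains are nested maxima: the inner one compares \<open>p\<close> organic plus the
  better ad of \<open>q\<close> and \<open>r\<close> with the two best ads, the outer one compares
  the outcome with \<open>p\<close> and \<open>q\<close> both organic.\<close>

lemma OBJ_CI_eq_change_given: "OBJ_CI G org 3 2 [p, q] = (\<integral>a. change_given (a r) \<partial>P)"
proof -
  have "{..<3} - {p} = {q, r}" using perm by auto
  then have "RC org 3 2 [p, q] (Suc 0) a = max (a q) (a r)" for a
    using pqr_neq topk_one_of_two[of q r] by (simp add: RC_def)
  moreover have "RC org 3 2 [p, q] (Suc (Suc 0)) a = org p" for a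
    by (simp add: RC_def topk_def)
  ultimately show ?thesis
    using pqr_neq
    by (simp add: OBJ_CI_def change_given_def numeral_2_eq_2
        topk_two_of_three[OF perm, unfolded numeral_2_eq_2])
qed

text \<open>By \<open>org_le\<close>, \<open>org p\<close> is at most the mean of
  \<open>max u (t p)\<close>; after this replacement each option is pointwise at most the sum of the
  two largest lifted values.\<close>

lemma change_le_lifted_aux:
  "max (org p + max v w) (\<integral>u. top2 u v w \<partial>G p) \<le>
    (\<integral>u. top2 (max u (t p)) (max v (t q)) (max w (t r)) \<partial>G p)" (is "_ \<le> ?R")
proof -
  interpret Gp: prob_space "G p" using prob pqr_less by auto
  note I = integrable_max_const[OF prob[OF pqr_less(1)] mean[OF pqr_less(1)]]
  have R: "integrable (G p) (\<lambda>u. top2 (max u (t p)) (max v (t q)) (max w (t r)))"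
    by (intro integrable_top2 I) auto
  have "org p + max v w \<le> (\<integral>u. max u (t p) + max v w \<partial>G p)"
    using org_le[OF pqr_less(1)] I by (simp add: Gp.prob_space)
  also have "\<dots> \<le> ?R"
    using R I by (intro integral_mono) (auto simp: top2_def max_def)
  finally have "org p + max v w \<le> ?R" .
  moreover have "(\<integral>u. top2 u v w \<partial>G p) \<le> ?R"
    by (intro integral_mono R integrable_top2 mean pqr_less top2_mono) auto
  ultimately show ?thesis by simp
qed

lemma measurable_inner:
  "(\<lambda>(v, w). max (org p + max v w) (\<integral>u. top2 u v w \<partial>G p)) \<in> borel_measurable (borel \<Otimes>\<^sub>M borel)"
  "(\<lambda>(v, w). \<integral>u. top2 (max u (t p)) (max v (t q)) (max w (t r)) \<partial>G p)
    \<in> borel_measurable (borel \<Otimes>\<^sub>M borel)"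
proof -
  interpret Gp: prob_space "G p" using prob pqr_less by auto
  note [measurable_cong] = sets_G[OF pqr_less(1)]
  show "(\<lambda>(v, w). max (org p + max v w) (\<integral>u. top2 u v w \<partial>G p)) \<in> borel_measurable (borel \<Otimes>\<^sub>M borel)"
    "(\<lambda>(v, w). \<integral>u. top2 (max u (t p)) (max v (t q)) (max w (t r)) \<partial>G p)
      \<in> borel_measurable (borel \<Otimes>\<^sub>M borel)"
    by measurable
qed

lemma lifted_inner_nonneg:
  "0 \<le> (\<integral>u. top2 (max u (t p)) (max v (t q)) (max w (t r)) \<partial>G p)"
  using t_nonneg pqr_less by (intro integral_nonneg_AE AE_I2 top2_nonneg) (auto simp: le_max_iff_disj)

text \<open>With nonnegative thresholds, \<open>top2\<close> of the lifted values is dominated by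
  the sum of all three.\<close>

lemma integrable_lifted_inner:
  "integrable (G q) (\<lambda>v. \<integral>u. top2 (max u (t p)) (max v (t q)) (max w (t r)) \<partial>G p)"
proof -
  interpret Gp: prob_space "G p" using prob pqr_less by auto
  interpret Gq: prob_space "G q" using prob pqr_less by auto
  note [measurable_cong] = sets_G[OF pqr_less(2)]
  note Ip = integrable_max_const[OF prob[OF pqr_less(1)] mean[OF pqr_less(1)]]
  note Iq = integrable_max_const[OF prob[OF pqr_less(2)] mean[OF pqr_less(2)]]
  have nn: "0 \<le> t p" "0 \<le> t q" "0 \<le> t r" using t_nonneg pqr_less by auto
  show ?thesis
  proof (rule Bochner_Integration.integrable_bound)
    show "integrable (G q) (\<lambda>v. (\<integral>u. max u (t p) \<partial>G p) + max v (t q) + max w (t r))"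
      using Iq by auto
    show "(\<lambda>v. \<integral>u. top2 (max u (t p)) (max v (t q)) (max w (t r)) \<partial>G p) \<in> borel_measurable (G q)"
      using measurable_compose[OF _ measurable_inner(2), of "\<lambda>v. (v, w)" "G q"] by simp
    have "norm (\<integral>u. top2 (max u (t p)) (max v (t q)) (max w (t r)) \<partial>G p)
      \<le> norm ((\<integral>u. max u (t p) \<partial>G p) + max v (t q) + max w (t r))" for v
    proof -
      have "(\<integral>u. top2 (max u (t p)) (max v (t q)) (max w (t r)) \<partial>G p)
          \<le> (\<integral>u. max u (t p) + (max v (t q) + max w (t r)) \<partial>G p)"
        by (intro integral_mono integrable_top2 Bochner_Integration.integrable_add Ip)
           (use nn in \<open>auto simp: top2_def max_def\<close>)
      then show ?thesis
        using Ip lifted_inner_nonneg[of v w] by (simp add: Gp.prob_space add.assoc)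
    qed
    then show "AE v in G q. norm (\<integral>u. top2 (max u (t p)) (max v (t q)) (max w (t r)) \<partial>G p)
      \<le> norm ((\<integral>u. max u (t p) \<partial>G p) + max v (t q) + max w (t r))" by simp
  qed
qed

lemma change_le_lifted: "change_given w \<le> lifted_given w"
proof -
  interpret Gp: prob_space "G p" using prob pqr_less by auto
  interpret Gq: prob_space "G q" using prob pqr_less by auto
  note Ip = integrable_max_const[OF prob[OF pqr_less(1)] mean[OF pqr_less(1)]]
  note Iq = integrable_max_const[OF prob[OF pqr_less(2)] mean[OF pqr_less(2)]]
  have "org p + org q \<le> (\<integral>v. (\<integral>u. max u (t p) + max v (t q) \<partial>G p) \<partial>G q)"
    using org_le[OF pqr_less(1)] org_le[OF pqr_less(2)] Ip Iq
    by (simp add: Gp.prob_space Gq.prob_space)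
  also have "\<dots> \<le> lifted_given w"
    unfolding lifted_given_def
  proof (rule integral_mono[OF _ integrable_lifted_inner])
    show "integrable (G q) (\<lambda>v. \<integral>u. max u (t p) + max v (t q) \<partial>G p)"
      using Ip Iq by (simp add: Gp.prob_space)
    show "(\<integral>u. max u (t p) + max v (t q) \<partial>G p)
        \<le> (\<integral>u. top2 (max u (t p)) (max v (t q)) (max w (t r)) \<partial>G p)" for v
      using Ip by (intro integral_mono integrable_top2) (auto simp: top2_def)
  qed
  finally have "org p + org q \<le> lifted_given w" .
  moreover have "(\<integral>v. max (org p + max v w) (\<integral>u. top2 u v w \<partial>G p) \<partial>G q) \<le> lifted_given w"
    unfolding lifted_given_def
    \<comment> \<open>\<open>integral_mono'\<close> takes integrability and nonnegativity of the
      upper function; a nonintegrable lower function has integral 0 by convention.\<close>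
    by (rule integral_mono'[OF integrable_lifted_inner change_le_lifted_aux lifted_inner_nonneg])
  ultimately show ?thesis by (simp add: change_given_def)
qed

lemma change_given_nonneg: "0 \<le> change_given w"
  using org_nonneg pqr_less by (auto simp: change_given_def le_max_iff_disj)

lemma OBJ_CI_le: "OBJ_CI G org 3 2 [p, q] \<le> V"
  unfolding OBJ_CI_eq_change_given V_eq_lifted_given(2)
  by (rule integral_mono'[OF V_eq_lifted_given(1) change_le_lifted])
     (rule order_trans[OF change_given_nonneg change_le_lifted])

end

section \<open>G-CHANGE attains \<open>V\<close> when the list follows decreasing thresholds\<close>

locale sorted_thresholds = labelled_thresholds +
  assumes t_sorted: "t r \<le> t q" "t q \<le> t p"
begin

lemma lifted_le_change:
  assumes w: "0 \<le> w"
  shows "lifted_given w \<le> change_given w"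
proof (cases "w < t q")
  case True
  interpret Gp: prob_space "G p" using prob pqr_less by auto
  interpret Gq: prob_space "G q" using prob pqr_less by auto
  note Ip = integrable_max_const[OF prob[OF pqr_less(1)] mean[OF pqr_less(1)]]
  note Iq = integrable_max_const[OF prob[OF pqr_less(2)] mean[OF pqr_less(2)]]
  \<comment> \<open>Here \<open>0 \<le> w < t q \<le> t p\<close>, so both thresholds are positive
    and \<open>org_eq\<close> applies to \<open>p\<close> and \<open>q\<close>.\<close>
  have "lifted_given w = org p + org q"
    using org_eq[OF pqr_less(1)] org_eq[OF pqr_less(2)] True w t_sorted Ip Iq
    by (simp add: lifted_given_def top2_lifted(1)[OF t_sorted True] Gp.prob_space Gq.prob_space)
  then show ?thesis by (simp add: change_given_def)
next
  case False
  then have qw: "t q \<le> w" by simp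
  interpret Gp: prob_space "G p" using prob pqr_less by auto
  note Ip = integrable_max_const[OF prob[OF pqr_less(1)] mean[OF pqr_less(1)]]
  note [measurable_cong] = sets_G[OF pqr_less(2)]
  have "AE v in G q. 0 \<le> v"
    using ads_nonneg pqr_less by auto
  \<comment> \<open>Nonnegativity turns the upper bound \<open>change_le_lifted_aux\<close> into a
    bound on norms, which yields integrability.\<close>
  then have pos: "AE v in G q. 0 \<le> max (org p + max v w) (\<integral>u. top2 u v w \<partial>G p)"
    by eventually_elim (use w org_nonneg[OF pqr_less(1)] in \<open>auto simp: le_max_iff_disj\<close>)
  have meas: "(\<lambda>v. max (org p + max v w) (\<integral>u. top2 u v w \<partial>G p)) \<in> borel_measurable (G q)"
    using measurable_compose[OF _ measurable_inner(1), of "\<lambda>v. (v, w)" "G q"] by simp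
  have "lifted_given w \<le> (\<integral>v. max (org p + max v w) (\<integral>u. top2 u v w \<partial>G p) \<partial>G q)"
    unfolding lifted_given_def
  proof (rule integral_mono_AE[OF integrable_lifted_inner])
    show "integrable (G q) (\<lambda>v. max (org p + max v w) (\<integral>u. top2 u v w \<partial>G p))"
    proof (rule Bochner_Integration.integrable_bound[OF integrable_lifted_inner meas])
      show "AE v in G q. norm (max (org p + max v w) (\<integral>u. top2 u v w \<partial>G p))
          \<le> norm (\<integral>u. top2 (max u (t p)) (max v (t q)) (max w (t r)) \<partial>G p)"
        using pos
        by eventually_elim (use change_le_lifted_aux lifted_inner_nonneg in \<open>simp add: abs_of_nonneg\<close>)
    qed
    show "AE v in G q. (\<integral>u. top2 (max u (t p)) (max v (t q)) (max w (t r)) \<partial>G p)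
        \<le> max (org p + max v w) (\<integral>u. top2 u v w \<partial>G p)"
      using \<open>AE v in G q. 0 \<le> v\<close>
    proof eventually_elim
      case (elim v)
      show ?case
      proof (cases "min v w < t p")
        case True
        \<comment> \<open>Nonnegative \<open>v\<close> and \<open>w\<close> with
          \<open>min v w < t p\<close> force a positive threshold, so \<open>org p\<close> equals
          the mean of \<open>max u (t p)\<close>.\<close>
        then have "0 < t p" using elim w by auto
        then show ?thesis
          using Ip org_eq[OF pqr_less(1)]
          by (simp add: top2_lifted(2)[OF t_sorted qw True] Gp.prob_space)
      next
        case False
        then have "t p \<le> min v w" by linarith
        then show ?thesis
          unfolding top2_lifted(3)[OF t_sorted qw \<open>t p \<le> min v w\<close>] by simp
      qed
    qed
  qed
  then show ?thesis by (simp add: change_given_def)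
qed

lemma OBJ_CI_sorted: "OBJ_CI G org 3 2 [p, q] = V"
proof -
  have "AE a in P. change_given (a r) = lifted_given (a r)"
    using AE_ads_nonneg
    by eventually_elim (use change_le_lifted lifted_le_change pqr_less in \<open>auto intro!: antisym\<close>)
  then have "AE a in P. lifted_given (a r) \<le> change_given (a r)"
    by eventually_elim simp
  moreover have "integrable P (\<lambda>a. change_given (a r))"
  proof (rule Bochner_Integration.integrable_bound[OF V_eq_lifted_given(1)])
    interpret Gq: prob_space "G q" using prob pqr_less by auto
    note [measurable_cong] = sets_G[OF pqr_less(2)]
    note [measurable] = measurable_ad[OF pqr_less(3)]
    \<comment> \<open>The pair is swapped so that the integrated variable \<open>v\<close> comes
      second, the form used for measurability of a parametrised integral.\<close>
    have "(\<lambda>(w, v). max (org p + max v w) (\<integral>u. top2 u v w \<partial>G p))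
        \<in> borel_measurable (borel \<Otimes>\<^sub>M G q)"
      using measurable_compose[OF _ measurable_inner(1), of "\<lambda>(w, v). (v, w)" "borel \<Otimes>\<^sub>M G q"]
      by (simp add: case_prod_beta')
    then have [measurable]: "change_given \<in> borel_measurable borel"
      unfolding change_given_def by measurable
    show "(\<lambda>a. change_given (a r)) \<in> borel_measurable P" by measurable
    show "AE a in P. norm (change_given (a r)) \<le> norm (lifted_given (a r))"
      using change_le_lifted change_given_nonneg
      by (auto intro!: AE_I2 simp: abs_of_nonneg order_trans[OF change_given_nonneg change_le_lifted])
  qed
  ultimately have "V \<le> OBJ_CI G org 3 2 [p, q]"
    unfolding OBJ_CI_eq_change_given V_eq_lifted_given(2)
    by (intro integral_mono_AE V_eq_lifted_given(1))
  then show ?thesis using OBJ_CI_le by simp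
qed

section \<open>The explicit mechanism is feasible and has value \<open>V\<close>\<close>

lemma measurable_change:
  "(\<lambda>a. change_x p q r a i) \<in> measurable P (count_space UNIV)"
  "(\<lambda>a. change_y p q r a i) \<in> measurable P (count_space UNIV)"
  unfolding change_x_def change_y_def
  by (intro pred_intros_logic borel_measurable_pred_less pred_real_le borel_measurable_max
    borel_measurable_min borel_measurable_const measurable_ad pqr_less; simp)+

lemma change_simps:
  "change_x p q r a p \<longleftrightarrow> t p \<le> min (a q) (a r) \<and> min (a q) (a r) < a p"
  "change_x p q r a q \<longleftrightarrow> t q \<le> a r \<and> (a r \<le> a q \<or> max (t p) (a p) \<le> min (a q) (a r))"
  "change_x p q r a r \<longleftrightarrow> t q \<le> a r \<and> (a q < a r \<or> max (t p) (a p) \<le> min (a q) (a r))"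
  "change_y p q r a p \<longleftrightarrow> min (a q) (a r) < t p"
  "change_y p q r a q \<longleftrightarrow> a r < t q"
  "change_y p q r a r = False"
  unfolding change_x_def change_y_def using pqr_neq by simp_all

lemma change_exclusive: "\<not> (change_x p q r a i \<and> change_y p q r a i)"
  unfolding change_x_def change_y_def using pqr_neq by (metis not_le)

text \<open>Exhaustive because \<open>a r < t q\<close> already gives
  \<open>min (a q) (a r) < t p\<close>, by \<open>t q \<le> t p\<close>.\<close>

lemma change_cases:
  obtains (both) "a r < t q" "min (a q) (a r) < t p"
  | (one) "t q \<le> a r" "min (a q) (a r) < t p"
  | (none) "t q \<le> a r" "t p \<le> min (a q) (a r)"
  using t_sorted by linarith

text \<open>With one organic item, the comparison of \<open>a q\<close> and \<open>a r\<close>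
  admits exactly one ad. With none, either \<open>p\<close> beats the smaller of the two and joins
  the larger, or both \<open>q\<close> and \<open>r\<close> are shown.\<close>

lemma change_slots: "(\<Sum>i<3. of_bool (change_x p q r a i) + of_bool (change_y p q r a i)) \<le> (2::nat)"
proof (cases a rule: change_cases)
  case both
  then have "\<not> t p \<le> min (a q) (a r)" "\<not> t q \<le> a r" by linarith+
  with both show ?thesis
    unfolding sum_pqr change_simps by (simp del: min.bounded_iff)
next
  case one
  then have "\<not> t p \<le> min (a q) (a r)" "\<not> max (t p) (a p) \<le> min (a q) (a r)" "\<not> a r < t q"
    by linarith+
  with one show ?thesis
    unfolding sum_pqr change_simps by (cases "a q < a r") simp_all
next
  case none
  then have "\<not> min (a q) (a r) < t p" "\<not> a r < t q" by linarith+
  with none show ?thesis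
    unfolding sum_pqr change_simps
    by (cases "min (a q) (a r) < a p"; cases "a q < a r") (simp_all add: not_le)
qed

lemma change_feasible: "feasible_mech G 3 2 (change_x p q r) (change_y p q r)"
  unfolding feasible_mech_def
proof (intro conjI allI impI measurable_change change_slots change_exclusive)
  fix a and i :: nat and v assume "i < 3"
  then consider "i = p" | "i = q" | "i = r" using less_3_iff by blast
  then show "change_y p q r (a(i := v)) i = change_y p q r a i"
    by cases (use pqr_neq in \<open>simp_all add: change_simps\<close>)
next
  fix a and i :: nat and v v' assume "i < 3" and v: "v \<le> v'" "change_x p q r (a(i := v)) i"
  then consider "i = p" | "i = q" | "i = r" using less_3_iff by blast
  then show "change_x p q r (a(i := v')) i"
    by cases (use pqr_neq v in \<open>auto simp: change_simps\<close>)
qed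

lemma change_value: "OBJ_mech G org 3 (change_x p q r) (change_y p q r) = V"
proof -
  note F = change_feasible[unfolded feasible_mech_def]
  have x: "(\<lambda>a. change_x p q r a i) \<in> measurable P (count_space UNIV)"
    and y: "(\<lambda>a. change_y p q r a i) \<in> measurable P (count_space UNIV)" if "i < 3" for i
    using F that by auto
  have "(\<integral>a. (\<Sum>i<3. a i * of_bool (change_x p q r a i)
        + max (a i) (t i) * of_bool (change_y p q r a i)) \<partial>P) = V"
    unfolding V_def
  proof (rule integral_cong_AE)
    show "(\<lambda>a. \<Sum>i<3. a i * of_bool (change_x p q r a i)
        + max (a i) (t i) * of_bool (change_y p q r a i)) \<in> borel_measurable P"
      by (intro borel_measurable_integrable Bochner_Integration.integrable_sum
          Bochner_Integration.integrable_add integrable_times_indicator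
          integrable_ad integrable_lifted x y) auto
    show "(\<lambda>a. topk 2 {..<3} (\<lambda>i. max (a i) (t i))) \<in> borel_measurable P"
      using integrable_V by blast
    show "AE a in P. (\<Sum>i<3. a i * of_bool (change_x p q r a i)
        + max (a i) (t i) * of_bool (change_y p q r a i)) = topk 2 {..<3} (\<lambda>i. max (a i) (t i))"
    proof (rule AE_I2)
      fix a
      show "(\<Sum>i<3. a i * of_bool (change_x p q r a i)
          + max (a i) (t i) * of_bool (change_y p q r a i)) = topk 2 {..<3} (\<lambda>i. max (a i) (t i))"
      proof (cases a rule: change_cases)
        case both
        then have "\<not> t p \<le> min (a q) (a r)" "\<not> t q \<le> a r" by linarith+
        with both show ?thesis
          unfolding sum_pqr topk_two_of_three[OF perm] top2_lifted(1)[OF t_sorted both(1)] change_simps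
          by (simp del: min.bounded_iff)
      next
        case one
        then have "\<not> t p \<le> min (a q) (a r)" "\<not> max (t p) (a p) \<le> min (a q) (a r)" "\<not> a r < t q"
          by linarith+
        with one show ?thesis
          unfolding sum_pqr topk_two_of_three[OF perm] top2_lifted(2)[OF t_sorted one] change_simps
          by (cases "a q < a r") simp_all
      next
        case none
        then have "\<not> min (a q) (a r) < t p" "\<not> a r < t q" by linarith+
        with none show ?thesis
          unfolding sum_pqr topk_two_of_three[OF perm] top2_lifted(3)[OF t_sorted none] change_simps
          unfolding top2_def
          by (cases "min (a q) (a r) < a p"; cases "a q < a r") (auto simp: not_le not_less)
      qed
    qed
  qed
  moreover have "(\<integral>a. org i * of_bool (change_y p q r a i) \<partial>P)
      = (\<integral>a. max (a i) (t i) * of_bool (change_y p q r a i) \<partial>P)" if i: "i < 3" for i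
  proof (rule organic_eq[OF i])
    \<comment> \<open>Showing \<open>i\<close> organically requires some ad value below
      \<open>t i\<close>; for \<open>t i = 0\<close> that value is negative, which has probability
      zero.\<close>
    show "AE a in P. \<not> change_y p q r a i" if "t i = 0"
      using AE_ads_nonneg
      by eventually_elim (use i that pqr_neq in \<open>auto simp: change_y_def less_3_iff min_less_iff_disj\<close>)
  qed (use F i in blast)+
  ultimately show ?thesis
    using lifted_value[OF x y] by simp
qed

end

section \<open>Comparison over all lists and existence of the thresholds\<close>

context thresholds
begin

lemma sorted_labels: "\<exists>p q r. sorted_thresholds G org t p q r"
proof -
  consider "t 2 \<le> t 1" "t 1 \<le> t 0" | "t 1 \<le> t 2" "t 2 \<le> t 0" | "t 2 \<le> t 0" "t 0 \<le> t 1"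
    | "t 0 \<le> t 2" "t 2 \<le> t 1" | "t 1 \<le> t 0" "t 0 \<le> t 2" | "t 0 \<le> t 1" "t 1 \<le> t 2"
    by linarith
  then have "\<exists>p q r. {p, q, r} = {..<3} \<and> distinct [p, q, r] \<and> t r \<le> t q \<and> t q \<le> t p"
  proof cases
    case 1 then show ?thesis by (intro exI[of _ 0] exI[of _ 1] exI[of _ 2]) auto
  next
    case 2 then show ?thesis by (intro exI[of _ 0] exI[of _ 2] exI[of _ 1]) auto
  next
    case 3 then show ?thesis by (intro exI[of _ 1] exI[of _ 0] exI[of _ 2]) auto
  next
    case 4 then show ?thesis by (intro exI[of _ 1] exI[of _ 2] exI[of _ 0]) auto
  next
    case 5 then show ?thesis by (intro exI[of _ 2] exI[of _ 0] exI[of _ 1]) auto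
  next
    case 6 then show ?thesis by (intro exI[of _ 2] exI[of _ 1] exI[of _ 0]) auto
  qed
  then obtain p q r where "{p, q, r} = {..<3}" "distinct [p, q, r]" "t r \<le> t q" "t q \<le> t p"
    by blast
  then have "sorted_thresholds G org t p q r"
    by unfold_locales
  then show ?thesis by blast
qed

lemma OBJ_C_eq: "OBJ_C G org 3 2 = V"
proof -
  obtain p q r where "sorted_thresholds G org t p q r" using sorted_labels by blast
  then interpret S: sorted_thresholds G org t p q r .
  have "finite {I. set I \<subseteq> {..<3::nat} \<and> length I = 2}"
    by (rule finite_lists_length_eq) simp
  then have fin: "finite (ordered_lists 3 2)"
    by (rule rev_finite_subset) (auto simp: ordered_lists_def)
  have "OBJ_CI G org 3 2 I \<le> V" if I: "I \<in> ordered_lists 3 2" for I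
  proof -
    obtain i j where ij: "I = [i, j]" "i \<noteq> j" "i < 3" "j < 3"
      using I by (auto simp: ordered_lists_def length_Suc_conv numeral_2_eq_2)
    \<comment> \<open>The indices 0, 1, 2 sum to 3, so \<open>3 - i - j\<close> is the item outside
      the list.\<close>
    then have "{i, j, 3 - i - j} = {..<3}" "distinct [i, j, 3 - i - j]"
      by (auto simp: numeral_3_eq_3 less_Suc_eq)
    then interpret labelled_thresholds G org t i j "3 - i - j"
      by unfold_locales
    show ?thesis using OBJ_CI_le ij by simp
  qed
  moreover have "V \<in> OBJ_CI G org 3 2 ` ordered_lists 3 2"
    using S.OBJ_CI_sorted S.pqr_less S.pqr_neq
    by (intro image_eqI[of _ _ "[p, q]"]) (auto simp: ordered_lists_def)
  ultimately show ?thesis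
    unfolding OBJ_C_def using fin by (intro Max_eqI) auto
qed

lemma exists_optimal_mechanism: "\<exists>x y. feasible_mech G 3 2 x y \<and> OBJ_mech G org 3 x y = V"
proof -
  obtain p q r where "sorted_thresholds G org t p q r" using sorted_labels by blast
  then interpret S: sorted_thresholds G org t p q r .
  show ?thesis using S.change_feasible S.change_value by blast
qed

end

lemma ex_thresholds:
  assumes "\<forall>i<3. prob_space (G i)" "\<forall>i<3. sets (G i) = sets borel"
    and "\<forall>i<3. integrable (G i) (\<lambda>v. v)" "\<forall>i<3. AE v in G i. 0 \<le> v" "\<forall>i<3. 0 \<le> org i"
  obtains t where "thresholds G org t"
proof -
  have "\<exists>s. 0 \<le> s \<and> org i \<le> (\<integral>v. max v s \<partial>G i) \<and> (0 < s \<longrightarrow> (\<integral>v. max v s \<partial>G i) = org i)"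
    if "i < 3" for i
    using expectation_max_threshold[of "G i" "org i"] assms that by metis
  then obtain t where t: "\<And>i. i < 3 \<Longrightarrow> 0 \<le> t i \<and> org i \<le> (\<integral>v. max v (t i) \<partial>G i) \<and>
      (0 < t i \<longrightarrow> (\<integral>v. max v (t i) \<partial>G i) = org i)"
    by metis
  have "thresholds G org t"
  proof (rule thresholds.intro)
    fix i :: nat assume "i < 3"
    from t[OF this] show "0 \<le> t i" "org i \<le> (\<integral>v. max v (t i) \<partial>G i)"
      "0 < t i \<Longrightarrow> org i = (\<integral>v. max v (t i) \<partial>G i)"
      by simp_all
  qed (use assms in blast)+
  then show ?thesis by (rule that)
qed

theorem theorem5:
  fixes G :: "nat \<Rightarrow> real measure" and org :: "nat \<Rightarrow> real"
  assumes reg: "\<forall>i<3. regular_dist (G i)"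
    and nonneg_ads: "\<forall>i<3. AE v in G i. 0 \<le> v"
    and finite_mean: "\<forall>i<3. integrable (G i) (\<lambda>v. v)"
    and nonneg_org: "\<forall>i<3. 0 \<le> org i"
  shows "(\<exists>x y. feasible_mech G 3 2 x y \<and> OBJ_mech G org 3 x y = OBJ_C G org 3 2) \<and>
         (\<forall>x y. feasible_mech G 3 2 x y \<longrightarrow> OBJ_mech G org 3 x y \<le> OBJ_C G org 3 2)"
proof -
  have "\<forall>i<3. prob_space (G i)" "\<forall>i<3. sets (G i) = sets borel"
    using reg by (auto simp: regular_dist_def)
  then obtain t where "thresholds G org t"
    using ex_thresholds finite_mean nonneg_ads nonneg_org by blast
  then interpret thresholds G org t .
  show ?thesis
    unfolding OBJ_C_eq using exists_optimal_mechanism mechanism_le by blast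
qed

end
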